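(* Let $P\subset\mathbb R^d$ be a polytope and $\mathbf c\in\mathbb R^d$ such that $\langle\cdot,\mathbf c\rangle$ attains its minimum and maximum over $P$ at unique vertices. Let $N_\ell$ be the number of $\mathbf c$-monotone paths (respectively coherent $\mathbf c$-monotone paths) of length $\ell$ on $P$, and $N'_\ell$ the number of $(\mathbf c,1)$-monotone paths (respectively coherent $(\mathbf c,1)$-monotone paths) of length $\ell$ on the prism $P\times[0,1]\subset\mathbb R^{d+1}$. If $(N_\ell)_\ell$ is log-concave, then $(N'_\ell)_\ell$ is log-concave. Furthermore, if the polynomial $x\mapsto\sum_\ell N_\ell x^\ell$ is real-rooted, then $x\mapsto\sum_\ell N'_\ell x^\ell$ is real-rooted.
   Context: For a polytope $P$ and $\mathbf c$ such that $\langle\cdot,\mathbf c\rangle$ has unique minimizing and maximizing vertices $v_{\min},v_{\max}$ on $P$, let $G_{P,\mathbf c}$ be the directed graph on the vertices of $P$ with an arc $u\to v$ whenever $[u,v]$ is an edge of $P$ with $\langle u,\mathbf c\rangle<\langle v,\mathbf c\rangle$. A $\mathbf c$-monotone path is a directed path in $G_{P,\mathbf c}$ from $v_{\min}$ to $v_{\max}$; its length is its number of edges. Such a path is coherent if there is $\boldsymbol\omega$ linearly independent from $\mathbf c$ such that the path is exactly the set of preimages, under $x\mapsto(\langle x,\mathbf c\rangle,\langle x,\boldsymbol\omega\rangle)$, of the upper faces of the polygon $\{(\langle x,\mathbf c\rangle,\langle x,\boldsymbol\omega\rangle):x\in P\}$ (a vertex or edge is an upper face if it has an outer normal with positive second coordinate).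 A sequence $(a_i)$ of nonnegative integers is log-concave if $a_{i-1}a_{i+1}\le a_i^2$ for all $i$. *)

theory Defs
  imports
    "HOL-Analysis.Analysis"
    "HOL-Computational_Algebra.Polynomial"
    "Graph_Theory.Pair_Digraph"
    "Graph_Theory.Vertex_Walk"
begin

definition min_vertex :: "'a::euclidean_space set \<Rightarrow> 'a \<Rightarrow> 'a \<Rightarrow> bool" where
  "min_vertex P c v \<longleftrightarrow> v extreme_point_of P \<and> (\<forall>x\<in>P. v \<bullet> c \<le> x \<bullet> c)"

definition max_vertex :: "'a::euclidean_space set \<Rightarrow> 'a \<Rightarrow> 'a \<Rightarrow> bool" where
  "max_vertex P c v \<longleftrightarrow> v extreme_point_of P \<and> (\<forall>x\<in>P. x \<bullet> c \<le> v \<bullet> c)"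

definition polytope_digraph :: "'a::euclidean_space set \<Rightarrow> 'a \<Rightarrow> 'a pair_pre_digraph" where
  "polytope_digraph P c =
    \<lparr> pverts = {v. v extreme_point_of P},
      parcs = {(u, v). u extreme_point_of P \<and> v extreme_point_of P \<and>
                       closed_segment u v edge_of P \<and> u \<bullet> c < v \<bullet> c} \<rparr>"

text \<open>Paths are given by their lists of vertices; the number of edges of \<open>p\<close> is
  \<^term>\<open>vwalk_length p\<close>.\<close>

definition monotone_paths :: "'a::euclidean_space set \<Rightarrow> 'a \<Rightarrow> 'a list set" where
  "monotone_paths P c =
    {p. vpath p (with_proj (polytope_digraph P c)) \<and>
        min_vertex P c (hd p) \<and> max_vertex P c (last p)}"

definition shadow_map :: "'a::euclidean_space \<Rightarrow> 'a \<Rightarrow> 'a \<Rightarrow> real \<times> real" where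
  "shadow_map c \<omega> x = (x \<bullet> c, x \<bullet> \<omega>)"

definition upper_faces :: "(real \<times> real) set \<Rightarrow> (real \<times> real) set set" where
  "upper_faces Q =
    {F. ((\<exists>q. q extreme_point_of Q \<and> F = {q}) \<or> F edge_of Q) \<and>
        (\<exists>n. snd n > 0 \<and> (\<forall>q\<in>F. \<forall>y\<in>Q. y \<bullet> n \<le> q \<bullet> n))}"

definition path_faces :: "'a::euclidean_space list \<Rightarrow> 'a set set" where
  "path_faces p = (\<lambda>v. {v}) ` set p \<union> (\<lambda>(u, v). closed_segment u v) ` set (vwalk_arcs p)"

text \<open>The conjunct \<^prop>\<open>\<omega> \<noteq> c\<close> is needed because \<^term>\<open>{c, \<omega>}\<close> is a set, not a family.\<close>

definition coherent :: "'a::euclidean_space set \<Rightarrow> 'a \<Rightarrow> 'a list \<Rightarrow> bool" where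
  "coherent P c p \<longleftrightarrow>
    (\<exists>\<omega>. \<omega> \<noteq> c \<and> independent {c, \<omega>} \<and>
         path_faces p =
           (\<lambda>F. {x \<in> P. shadow_map c \<omega> x \<in> F}) ` upper_faces (shadow_map c \<omega> ` P))"

definition coherent_monotone_paths :: "'a::euclidean_space set \<Rightarrow> 'a \<Rightarrow> 'a list set" where
  "coherent_monotone_paths P c = {p \<in> monotone_paths P c. coherent P c p}"

definition length_count :: "'a list set \<Rightarrow> nat \<Rightarrow> nat" where
  "length_count S l = card {p \<in> S. vwalk_length p = l}"

definition log_concave :: "(nat \<Rightarrow> nat) \<Rightarrow> bool" where
  "log_concave a \<longleftrightarrow> (\<forall>i\<ge>1. a (i - 1) * a (i + 1) \<le> (a i)\<^sup>2)"

text \<open>The generating polynomial of a finitely supported sequence.\<close>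

definition gen_poly :: "(nat \<Rightarrow> nat) \<Rightarrow> real poly" where
  "gen_poly a = (\<Sum>l | a l \<noteq> 0. monom (real (a l)) l)"

definition real_rooted :: "real poly \<Rightarrow> bool" where
  "real_rooted f \<longleftrightarrow> (\<forall>z::complex. poly (map_poly of_real f) z = 0 \<longrightarrow> z \<in> \<real>)"

text \<open>A polytope has finitely many monotone paths, so their length counts are finitely supported
  and \<^const>\<open>card\<close> and \<^const>\<open>gen_poly\<close> do not take their default value for infinite sets.\<close>

lemma finite_monotone_paths:
  assumes "polytope P"
  shows "finite (monotone_paths P c)"
proof -
  have "finite {v. v extreme_point_of P}"
    using assms finite_polyhedron_extreme_points polytope_imp_polyhedron by blast
  then have "finite {p. set p \<subseteq> {v. v extreme_point_of P} \<and> distinct p}"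
    using finite_subset_distinct by blast
  moreover have "monotone_paths P c \<subseteq> {p. set p \<subseteq> {v. v extreme_point_of P} \<and> distinct p}"
    by (auto simp: monotone_paths_def vpath_def vwalk_def polytope_digraph_def)
  ultimately show ?thesis
    by (rule rev_finite_subset)
qed

lemma finite_length_count_support:
  assumes "finite S"
  shows "finite {l. length_count S l \<noteq> 0}"
proof -
  have "{l. length_count S l \<noteq> 0} \<subseteq> vwalk_length ` S"
    by (auto simp: length_count_def card_eq_0_iff)
  then show ?thesis
    using assms finite_surj by blast
qed

lemma coeff_gen_poly:
  assumes "finite {l. a l \<noteq> 0}"
  shows "coeff (gen_poly a) k = real (a k)"
  using assms by (auto simp: gen_poly_def coeff_sum)

end

theory Submission
  imports Defs "HOL-Computational_Algebra.Fundamental_Theorem_Algebra"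
begin

text \<open>
  A monotone path on the prism follows a monotone path \<open>p\<close> of \<open>P\<close> in the bottom copy, climbs the
  vertical edge at one of the vertices of \<open>p\<close>, and continues in the top copy, so
  \<open>N'\<^bsub>l+1\<^esub> = (l+1) N\<^bsub>l\<^esub>\<close>. This preserves log-concavity, and the generating polynomials satisfy
  \<open>F = x (x f)'\<close>, where differentiation preserves real-rootedness since the logarithmic derivative
  of a real-rooted polynomial has nonzero imaginary part off the real axis.

  The same count holds for coherent paths: the preimages of the upper faces are the faces of \<open>P\<close>
  maximising \<open>\<omega> - s c\<close> as \<open>s\<close> ranges over the reals, and on the prism \<open>(\<omega>, t)\<close> yields the same
  faces, in the top copy for \<open>s < t\<close> and in the bottom copy for \<open>s > t\<close>. Choosing \<open>t\<close> with maximal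
  face \<open>{v}\<close> places the vertical edge at \<open>v\<close>. The exception is an ambient space spanned by \<open>c\<close>
  (or \<open>c = 0\<close>): there no path of \<open>P\<close> is coherent, and \<open>N'\<close> is supported on \<open>{1, 2}\<close>.
\<close>

section \<open>Log-concavity and real-rootedness\<close>

text \<open>A real root \<open>x\<close> contributes \<open>1 / (z - x)\<close> to the logarithmic
  derivative, and the imaginary part of this term has the sign opposite to \<open>Im z\<close>. The
  weak inequality, valid also for the empty product, carries the induction.\<close>

lemma Im_logderiv_prod_linear:
  fixes A :: "complex multiset" and z :: complex
  assumes "Im z \<noteq> 0" and "\<And>x. x \<in># A \<Longrightarrow> x \<in> \<real>"
  defines "q \<equiv> \<Prod>x\<in>#A. [:-x, 1:]"
  shows "poly q z \<noteq> 0 \<and> Im (poly (pderiv q) z / poly q z) * Im z \<le> 0 \<and>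
    (A \<noteq> {#} \<longrightarrow> Im (poly (pderiv q) z / poly q z) * Im z < 0)"
  using assms(2) unfolding q_def
proof (induction A)
  case empty
  then show ?case by simp
next
  case (add x A)
  define r where "r = (\<Prod>x\<in>#A. [:-x, 1:])"
  have IH: "poly r z \<noteq> 0" "Im (poly (pderiv r) z / poly r z) * Im z \<le> 0"
    using add by (auto simp: r_def)
  have "x \<in> \<real>" using add.prems by simp
  then have im: "Im (z - x) = Im z" by (simp add: complex_is_Real_iff)
  then have zx: "z - x \<noteq> 0" using assms(1) by auto
  have eq: "(\<Prod>x\<in>#add_mset x A. [:-x, 1:]) = [:-x, 1:] * r"
    by (simp add: r_def)
  have "poly (pderiv ([:-x, 1:] * r)) z = (z - x) * poly (pderiv r) z + poly r z"
    unfolding pderiv_mult by (simp add: pderiv_pCons algebra_simps)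
  then have "poly (pderiv ([:-x, 1:] * r)) z / poly ([:-x, 1:] * r) z =
      poly (pderiv r) z / poly r z + 1 / (z - x)"
    using IH(1) zx by (simp add: field_simps)
  moreover have "Im (1 / (z - x)) * Im z < 0"
  proof -
    have "Im (1 / (z - x)) * Im z = - ((Im z)\<^sup>2 / (cmod (z - x))\<^sup>2)"
      unfolding Im_divide cmod_power2 using im by (simp add: power2_eq_square)
    moreover have "(Im z)\<^sup>2 / (cmod (z - x))\<^sup>2 > 0"
      using assms(1) zx by simp
    ultimately show ?thesis by linarith
  qed
  ultimately have "Im (poly (pderiv ([:-x, 1:] * r)) z / poly ([:-x, 1:] * r) z) * Im z < 0"
    using IH(2) by (simp add: distrib_right)
  moreover have "poly ([:-x, 1:] * r) z \<noteq> 0"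
    using IH(1) zx by simp
  ultimately show ?case unfolding eq by auto
qed

text \<open>Over the complex numbers \<open>f\<close> splits into linear factors with real roots, so
  off the real axis its logarithmic derivative is nonzero. Positive degree prevents the derivative
  from being 0, which is not \<open>real_rooted\<close>.\<close>

lemma real_rooted_pderiv:
  assumes "real_rooted f" and "degree f > 0"
  shows "real_rooted (pderiv f)"
  unfolding real_rooted_def
proof (intro allI impI)
  fix z :: complex
  define g :: "complex poly" where "g = map_poly of_real f"
  assume "poly (map_poly of_real (pderiv f)) z = 0"
  moreover have "map_poly of_real (pderiv f) = pderiv g"
    by (rule poly_eqI) (simp add: g_def coeff_map_poly coeff_pderiv)
  ultimately have z: "poly (pderiv g) z = 0" by simp
  have deg: "degree g > 0"
    using assms(2) by (simp add: g_def degree_map_poly)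
  then have "g \<noteq> 0" by auto
  then obtain A where A: "size A = degree g" "g = smult (lead_coeff g) (\<Prod>x\<in>#A. [:-x, 1:])"
    using alg_closed_imp_factorization by blast
  define q :: "complex poly" where "q = (\<Prod>x\<in>#A. [:-x, 1:])"
  have g: "g = smult (lead_coeff g) q" using A(2) q_def by simp
  have "x \<in> \<real>" if "x \<in># A" for x
  proof -
    have "poly q x = 0"
      using that unfolding q_def by (induction A) auto
    then have "poly g x = 0" by (subst g) simp
    then show ?thesis using assms(1) by (simp add: real_rooted_def g_def)
  qed
  then have q: "Im (poly (pderiv q) z / poly q z) * Im z < 0" if "Im z \<noteq> 0" "A \<noteq> {#}"
    using Im_logderiv_prod_linear[OF that(1), of A] that(2) unfolding q_def by blast
  have "poly (pderiv q) z = 0"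
    using z \<open>g \<noteq> 0\<close> by (subst (asm) g) (simp add: pderiv_smult)
  moreover have "A \<noteq> {#}" using A(1) deg by auto
  ultimately have "Im z = 0"
    using q by auto
  then show "z \<in> \<real>" by (simp add: complex_is_Real_iff)
qed

text \<open>The zero polynomial vanishes at the imaginary unit, so a real-rooted generating
  polynomial forces at least one path to exist.\<close>

lemma not_real_rooted_0: "\<not> real_rooted 0"
  unfolding real_rooted_def by (auto intro!: exI[of _ \<i>] simp: complex_is_Real_iff)

lemma real_rooted_pCons_0_iff: "real_rooted (pCons 0 f) \<longleftrightarrow> real_rooted f"
  by (auto simp: real_rooted_def map_poly_pCons)

lemma real_rooted_gen_poly_shift:
  assumes fin: "finite {l. a l \<noteq> 0}"
    and b: "b 0 = 0" "\<And>l. b (Suc l) = Suc l * a l"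
    and rr: "real_rooted (gen_poly a)"
  shows "real_rooted (gen_poly b)"
proof -
  have "{l. b l \<noteq> 0} \<subseteq> Suc ` {l. a l \<noteq> 0}"
  proof
    fix l assume "l \<in> {l. b l \<noteq> 0}"
    then show "l \<in> Suc ` {l. a l \<noteq> 0}" using b by (cases l) auto
  qed
  then have finb: "finite {l. b l \<noteq> 0}"
    using fin finite_surj by blast
  \<comment> \<open>Multiplying a nonzero polynomial by x gives positive degree, as
    \<open>real_rooted_pderiv\<close> requires.\<close>
  have "gen_poly a \<noteq> 0" using rr not_real_rooted_0 by auto
  moreover have "gen_poly b = pCons 0 (pderiv (pCons 0 (gen_poly a)))"
  proof (rule poly_eqI)
    fix n show "coeff (gen_poly b) n = coeff (pCons 0 (pderiv (pCons 0 (gen_poly a)))) n"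
      using b by (cases n) (simp_all add: coeff_gen_poly[OF fin] coeff_gen_poly[OF finb] coeff_pderiv algebra_simps)
  qed
  ultimately show ?thesis
    using rr by (simp add: real_rooted_pCons_0_iff real_rooted_pderiv)
qed

text \<open>The termwise product of log-concave sequences is log-concave; the extra factors satisfy
  \<open>(n + 1) * (n + 3) \<le> (n + 2)^2\<close>.\<close>

lemma log_concave_shift:
  assumes b: "b 0 = 0" "\<And>l. b (Suc l) = Suc l * a l"
    and lc: "log_concave a"
  shows "log_concave b"
  unfolding log_concave_def
proof (intro allI impI)
  fix i :: nat assume "i \<ge> 1"
  then obtain m where i: "i = Suc m" by (cases i) auto
  show "b (i - 1) * b (i + 1) \<le> (b i)\<^sup>2"
  proof (cases m)
    case 0 then show ?thesis using i b(1) by simp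
  next
    case (Suc n)
    have "a n * a (Suc (Suc n)) \<le> (a (Suc n))\<^sup>2"
      using lc[unfolded log_concave_def, rule_format, of "Suc n"] by simp
    moreover have "Suc n * Suc (Suc (Suc n)) \<le> (Suc (Suc n))\<^sup>2"
      by (simp add: power2_eq_square)
    ultimately have "(Suc n * Suc (Suc (Suc n))) * (a n * a (Suc (Suc n)))
        \<le> (Suc (Suc n))\<^sup>2 * (a (Suc n))\<^sup>2"
      by (rule mult_le_mono[rotated])
    moreover have "i - 1 = Suc n" "i + 1 = Suc (Suc (Suc n))" "i = Suc (Suc n)"
      using i Suc by simp_all
    ultimately show ?thesis
      by (simp only: b power_mult_distrib mult.commute mult.left_commute mult.assoc)
  qed
qed

text \<open>The indices \<open>i - 1\<close> and \<open>i + 1\<close> differ by two, so they cannot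
  both lie in the support.\<close>

lemma log_concave_support_1_2:
  assumes "\<And>l. a l \<noteq> 0 \<Longrightarrow> l = 1 \<or> l = 2"
  shows "log_concave a"
  unfolding log_concave_def
proof (intro allI impI)
  fix i :: nat assume "i \<ge> 1"
  then have "a (i - 1) = 0 \<or> a (i + 1) = 0"
    using assms[of "i - 1"] assms[of "i + 1"] by force
  then show "a (i - 1) * a (i + 1) \<le> (a i)\<^sup>2" by auto
qed

section \<open>Monotone paths on the prism\<close>

text \<open>\<open>k\<close> is the index of the vertex at which the path climbs; that vertex occurs
  in both copies, hence the overlap of \<open>take (Suc k)\<close> and
  \<open>drop k\<close>.\<close>

definition lift_path :: "nat \<Rightarrow> 'a list \<Rightarrow> ('a \<times> real) list" where
  "lift_path k p = map (\<lambda>v. (v, 0)) (take (Suc k) p) @ map (\<lambda>v. (v, 1)) (drop k p)"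

lemma lift_path_0 [simp]: "lift_path 0 (u # p) = (u, 0) # (u, 1) # map (\<lambda>v. (v, 1)) p"
  and lift_path_Suc [simp]: "lift_path (Suc k) (u # p) = (u, 0) # lift_path k p"
  by (simp_all add: lift_path_def)

lemma length_lift_path: "k < length p \<Longrightarrow> length (lift_path k p) = Suc (length p)"
  by (simp add: lift_path_def)

lemma lift_path_append:
  "lift_path (length xs) (xs @ v # ys) = map (\<lambda>v. (v, 0)) (xs @ [v]) @ map (\<lambda>v. (v, 1)) (v # ys)"
  by (simp add: lift_path_def)

lemma hd_lift_path: "k < length p \<Longrightarrow> hd (lift_path k p) = (hd p, 0)"
  and last_lift_path: "k < length p \<Longrightarrow> last (lift_path k p) = (last p, 1)"
  by (cases p; simp add: lift_path_def) (simp add: lift_path_def last_map)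

text \<open>The number of vertices at height 0 reveals \<open>k\<close>; dropping one of the two
  copies of the climbing vertex and projecting recovers \<open>p\<close>.\<close>

lemma inj_on_lift_path: "inj_on (\<lambda>(p, k). lift_path k p) {(p, k). k < length p}"
proof (rule inj_onI, clarsimp)
  fix p q :: "'a list" and k j
  assume k: "k < length p" and j: "j < length q" and eq: "lift_path k p = lift_path j q"
  have count: "length (filter (\<lambda>x. snd x = 0) (lift_path k p)) = Suc k"
    if "k < length p" for k and p :: "'a list"
    using that by (simp add: lift_path_def filter_map o_def)
  have "k = j" using count[OF k] count[OF j] eq by simp
  have recover: "p = map fst (take k (lift_path k p)) @ map fst (drop (Suc k) (lift_path k p))"
    if "k < length p" for k and p :: "'a list"
    using that by (simp add: lift_path_def take_map o_def)
  show "p = q \<and> k = j"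
    using recover[OF k] recover[OF j] eq \<open>k = j\<close> by simp
qed

text \<open>A path with \<open>l\<close> edges has \<open>l + 1\<close> vertices, each a possible
  place to climb. \<open>S\<close> is arbitrary so that the count serves all monotone paths as well
  as the coherent ones.\<close>

lemma length_count_lift_path:
  assumes "finite S" and "\<And>p. p \<in> S \<Longrightarrow> p \<noteq> []"
    and S': "S' = {lift_path k p |k p. p \<in> S \<and> k < length p}"
  shows "length_count S' 0 = 0" "length_count S' (Suc l) = Suc l * length_count S l"
proof -
  have "{q \<in> S'. vwalk_length q = 0} = {}"
    using length_lift_path unfolding S' by fastforce
  then show "length_count S' 0 = 0" unfolding length_count_def by (simp only: card.empty)
  let ?D = "{p \<in> S. vwalk_length p = l} \<times> {..l}"
  \<comment> \<open>Nonemptiness matters here: the empty list has \<open>vwalk_length\<close> 0 as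
    well.\<close>
  have D: "vwalk_length p = l \<longleftrightarrow> length p = Suc l" if "p \<in> S" for p
    using that assms(2)[of p] by (cases p) auto
  have "{q \<in> S'. vwalk_length q = Suc l} = (\<lambda>(p, k). lift_path k p) ` ?D"
  proof (intro set_eqI iffI)
    fix q assume "q \<in> {q \<in> S'. vwalk_length q = Suc l}"
    then obtain k p where "q = lift_path k p" "p \<in> S" "k < length p" "length q = Suc (Suc l)"
      unfolding S' by auto
    then show "q \<in> (\<lambda>(p, k). lift_path k p) ` ?D"
      by (intro image_eqI[of _ _ "(p, k)"]) (auto simp: length_lift_path)
  next
    fix q assume "q \<in> (\<lambda>(p, k). lift_path k p) ` ?D"
    then obtain k p where q: "q = lift_path k p" "p \<in> S" "k \<le> l" "vwalk_length p = l"
      by auto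
    then have "length p = Suc l" using D by blast
    moreover from this have "k < length p" using q(3) by simp
    ultimately show "q \<in> {q \<in> S'. vwalk_length q = Suc l}"
      using q(1,2) length_lift_path[of k p] unfolding S' by (intro CollectI conjI) (blast, simp)
  qed
  moreover have "inj_on (\<lambda>(p, k). lift_path k p) ?D"
  proof (rule inj_on_subset[OF inj_on_lift_path], rule subsetI)
    fix x assume "x \<in> ?D"
    then have "length (fst x) = Suc l" "snd x \<le> l" using D[of "fst x"] by auto
    then show "x \<in> {(p, k). k < length p}" by (simp add: case_prod_beta)
  qed
  ultimately show "length_count S' (Suc l) = Suc l * length_count S l"
    by (simp add: length_count_def card_image card_cartesian_product)
qed

section \<open>Vertices and arcs of the prism digraph\<close>

lemma pverts_polytope_digraph [simp]:
  "pverts (polytope_digraph P c) = {v. v extreme_point_of P}"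
  by (simp add: polytope_digraph_def)

text \<open>The strict inequality separates the end points, so the segment has affine dimension 1
  and being an edge reduces to being a face, which suits products.\<close>

lemma parcs_polytope_digraph:
  "(u, v) \<in> parcs (polytope_digraph P c) \<longleftrightarrow>
    u extreme_point_of P \<and> v extreme_point_of P \<and> closed_segment u v face_of P \<and> u \<bullet> c < v \<bullet> c"
proof -
  have "aff_dim (closed_segment u v) = 1" if "u \<bullet> c < v \<bullet> c"
    using that by (auto simp: segment_convex_hull aff_dim_convex_hull)
  then show ?thesis
    by (auto simp: polytope_digraph_def edge_of_def)
qed

lemma vwalk_Cons_Cons:
  "vwalk (u # v # p) G \<longleftrightarrow> u \<in> verts G \<and> (u, v) \<in> arcs_ends G \<and> vwalk (v # p) G"
  by (auto simp: vwalk_def)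

lemma sorted_wrt_vwalk:
  assumes "vwalk p (with_proj (polytope_digraph P c))"
  shows "sorted_wrt (\<lambda>u v. u \<bullet> c < v \<bullet> c) p"
  using assms
proof (induction p rule: vwalk_arcs.induct)
  case (3 x y xs)
  then show ?case
    by (auto simp: vwalk_Cons_Cons parcs_polytope_digraph intro: less_trans)
qed auto

text \<open>The value of \<open>c\<close> increases strictly along a walk, so no vertex repeats and
  walks are paths.\<close>

lemma monotone_paths_iff:
  "p \<in> monotone_paths P c \<longleftrightarrow> vwalk p (with_proj (polytope_digraph P c)) \<and>
    min_vertex P c (hd p) \<and> max_vertex P c (last p)"
proof -
  have "distinct p" if "vwalk p (with_proj (polytope_digraph P c))"
    using sorted_wrt_vwalk[OF that] by (induction p) auto
  then show ?thesis by (auto simp: monotone_paths_def vpath_def)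
qed

lemma extreme_point_of_unit_interval [simp]: "a extreme_point_of {0..1::real} \<longleftrightarrow> a = 0 \<or> a = 1"
  using extreme_point_of_segment[of a 0 "1::real"] by (simp add: closed_segment_eq_real_ivl)

lemma extreme_point_of_prism:
  fixes P :: "'a::euclidean_space set"
  shows "(u, a) extreme_point_of P \<times> {0..1::real} \<longleftrightarrow> u extreme_point_of P \<and> (a = 0 \<or> a = 1)"
proof -
  have "{(u, a)} = {u} \<times> {a}" by auto
  then show ?thesis
    using face_of_Times_eq[of "{u}" "{a}" P "{0..1::real}"] by (simp add: face_of_singleton)
qed

lemma closed_segment_horizontal: "closed_segment (u, a) (v, a) = closed_segment u v \<times> {a}"
  by (auto simp: in_segment scaleR_left_distrib[symmetric])

lemma closed_segment_vertical: "closed_segment (u, a) (u, b) = {u} \<times> closed_segment a b"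
  by (auto simp: in_segment scaleR_left_distrib[symmetric])

lemma parcs_prism:
  "((u, a), (v, b)) \<in> parcs (polytope_digraph (P \<times> {0..1::real}) (c, 1)) \<longleftrightarrow>
    (a = b \<and> (a = 0 \<or> a = 1) \<and> (u, v) \<in> parcs (polytope_digraph P c)) \<or>
    (u = v \<and> u extreme_point_of P \<and> a = 0 \<and> b = 1)"
    (is "?L \<longleftrightarrow> ?H \<or> ?V")
proof
  assume ?L
  then have ext: "u extreme_point_of P" "v extreme_point_of P" "a = 0 \<or> a = 1" "b = 0 \<or> b = 1"
    and face: "closed_segment (u, a) (v, b) face_of P \<times> {0..1}"
    and less: "u \<bullet> c + a < v \<bullet> c + b"
    by (auto simp: parcs_polytope_digraph extreme_point_of_prism)
  obtain F F' where F: "F face_of P" "F' face_of {0..1::real}" "closed_segment (u, a) (v, b) = F \<times> F'"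
    using face face_of_Times_decomp by blast
  \<comment> \<open>The segment is a product of faces; if both coordinates changed, it would contain
    the corner \<open>(u, b)\<close>, which is off the diagonal.\<close>
  have "u = v \<or> a = b"
  proof (rule ccontr)
    assume neq: "\<not> (u = v \<or> a = b)"
    have "(u, a) \<in> F \<times> F'" "(v, b) \<in> F \<times> F'" unfolding F(3)[symmetric] by auto
    then have "(u, b) \<in> closed_segment (u, a) (v, b)" unfolding F(3) by auto
    then obtain t where "u = (1 - t) *\<^sub>R u + t *\<^sub>R v" "b = (1 - t) * a + t * b"
      by (auto simp: in_segment)
    then have "t *\<^sub>R (v - u) = 0" "(1 - t) * (b - a) = 0" by (auto simp: algebra_simps)
    then show False using neq by auto
  qed
  then show "?H \<or> ?V"
  proof
    assume uv: "u = v"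
    then have ?V using ext less by auto
    then show ?thesis ..
  next
    assume "a = b"
    then have "closed_segment u v face_of P"
      using face by (simp add: closed_segment_horizontal face_of_Times_eq)
    then have ?H using ext less \<open>a = b\<close> by (simp add: parcs_polytope_digraph)
    then show ?thesis ..
  qed
next
  assume "?H \<or> ?V"
  then show ?L
    by (auto simp: parcs_polytope_digraph extreme_point_of_prism closed_segment_horizontal
        closed_segment_vertical face_of_Times_eq face_of_singleton closed_segment_eq_real_ivl
        face_of_refl)
qed

section \<open>Walks on the prism as lifted walks\<close>

context
  fixes P :: "'a::euclidean_space set" and c :: 'a
begin

abbreviation (input) "base_graph \<equiv> with_proj (polytope_digraph P c)"
abbreviation (input) "prism_graph \<equiv> with_proj (polytope_digraph (P \<times> {0..1::real}) (c, 1))"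

lemma vwalk_prism_level_iff:
  assumes "a = 0 \<or> a = 1"
  shows "vwalk (map (\<lambda>v. (v, a)) p) prism_graph \<longleftrightarrow> vwalk p base_graph"
proof (induction p rule: vwalk_arcs.induct)
  case 1
  then show ?case by (simp add: vwalk_def)
next
  case (2 x)
  then show ?case using assms by (auto simp: vwalk_def extreme_point_of_prism)
next
  case (3 x y xs)
  then show ?case
    using assms by (auto simp: vwalk_Cons_Cons parcs_prism extreme_point_of_prism)
qed

lemma vwalk_lift_path:
  assumes "vwalk p base_graph" and "k < length p"
  shows "vwalk (lift_path k p) prism_graph"
  using assms
proof (induction p arbitrary: k rule: list.induct)
  case (Cons u p)
  have u: "u extreme_point_of P" using Cons.prems by (auto simp: vwalk_def)
  show ?case
  proof (cases k)
    case 0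
    then show ?thesis
      using u Cons.prems vwalk_prism_level_iff[of 1 "u # p"]
      by (simp add: vwalk_Cons_Cons extreme_point_of_prism parcs_prism)
  next
    case (Suc j)
    then obtain v p' where p: "p = v # p'" using Cons.prems by (cases p) auto
    then have "vwalk (lift_path j p) prism_graph"
      using Cons Suc by (auto simp: vwalk_Cons_Cons)
    moreover obtain q where "lift_path j p = (v, 0) # q"
      using p by (cases j) auto
    ultimately show ?thesis
      using Suc Cons.prems u p
      by (auto simp: vwalk_Cons_Cons extreme_point_of_prism parcs_prism)
  qed
qed simp

text \<open>Vertical arcs only go up, so a walk that starts at height 1 stays there.\<close>

lemma vwalk_prism_top:
  assumes "vwalk q prism_graph" and "snd (hd q) = 1"
  obtains p where "vwalk p base_graph" "q = map (\<lambda>v. (v, 1)) p"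
proof -
  have "\<forall>x\<in>set q. snd x = 1"
    using assms
  proof (induction q rule: vwalk_arcs.induct)
    case (3 x y xs)
    then show ?case
      by (cases x; cases y) (auto simp: vwalk_Cons_Cons parcs_prism)
  qed auto
  then have "q = map (\<lambda>v. (v, 1)) (map fst q)"
    by (auto simp: o_def intro!: map_idI[symmetric] prod_eqI)
  then show ?thesis
    using that assms(1) vwalk_prism_level_iff[of 1 "map fst q"] by metis
qed

text \<open>Induction on the walk: a horizontal first arc raises the climbing index by one, a
  vertical first arc gives index 0 and leaves a walk in the top copy.\<close>

lemma vwalk_prism_imp_lift_path:
  assumes "vwalk q prism_graph" and "snd (hd q) = 0" and "snd (last q) = 1"
  shows "\<exists>p k. vwalk p base_graph \<and> k < length p \<and> q = lift_path k p"
  using assms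
proof (induction q rule: vwalk_arcs.induct)
  case (3 x y xs)
  obtain u v b where x: "x = (u, 0)" and y: "y = (v, b)"
    using 3(3) by (cases x; cases y) auto
  have w: "vwalk (y # xs) prism_graph" and u: "u extreme_point_of P"
    and arc: "((u, 0), (v, b)) \<in> parcs (polytope_digraph (P \<times> {0..1::real}) (c, 1))"
    using 3(2) x y by (auto simp: vwalk_Cons_Cons extreme_point_of_prism)
  from arc consider (horizontal) "b = 0" "(u, v) \<in> parcs (polytope_digraph P c)"
    | (vertical) "b = 1" "v = u"
    by (auto simp: parcs_prism)
  then show ?case
  proof cases
    case horizontal
    then obtain p k where p: "vwalk p base_graph" "k < length p" "y # xs = lift_path k p"
      using 3(1)[OF w] 3(4) y by auto
    then have "y = (hd p, 0)" by (metis hd_lift_path list.sel(1))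
    then obtain p' where "p = v # p'"
      using p(2) y by (cases p) auto
    then show ?thesis
      using p horizontal u x
      by (intro exI[of _ "u # p"] exI[of _ "Suc k"]) (auto simp: vwalk_Cons_Cons)
  next
    case vertical
    then obtain p where p: "vwalk p base_graph" "y # xs = map (\<lambda>v. (v, 1)) p"
      using vwalk_prism_top[OF w] y by auto
    then obtain p' where "p = u # p'"
      using y vertical by (cases p) auto
    then show ?thesis
      using p x by (intro exI[of _ p] exI[of _ 0]) auto
  qed
qed auto

lemma min_vertex_prism:
  "min_vertex (P \<times> {0..1::real}) (c, 1) (x, y) \<longleftrightarrow> min_vertex P c x \<and> y = 0"
proof
  assume L: "min_vertex (P \<times> {0..1::real}) (c, 1) (x, y)"
  then have x: "x extreme_point_of P" "y = 0 \<or> y = 1"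
    and min: "\<And>x' y'. x' \<in> P \<Longrightarrow> 0 \<le> y' \<Longrightarrow> y' \<le> 1 \<Longrightarrow> x \<bullet> c + y \<le> x' \<bullet> c + y'"
    by (auto simp: min_vertex_def extreme_point_of_prism)
  have "x \<in> P" using x by (simp add: extreme_point_of_def)
  then have "y = 0" using min[of x 0] x(2) by auto
  then show "min_vertex P c x \<and> y = 0"
    using x min[of _ 0] by (auto simp: min_vertex_def)
qed (auto simp: min_vertex_def extreme_point_of_prism intro: add_increasing2)

lemma max_vertex_prism:
  "max_vertex (P \<times> {0..1::real}) (c, 1) (x, y) \<longleftrightarrow> max_vertex P c x \<and> y = 1"
proof
  assume L: "max_vertex (P \<times> {0..1::real}) (c, 1) (x, y)"
  then have x: "x extreme_point_of P" "y = 0 \<or> y = 1"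
    and max: "\<And>x' y'. x' \<in> P \<Longrightarrow> 0 \<le> y' \<Longrightarrow> y' \<le> 1 \<Longrightarrow> x' \<bullet> c + y' \<le> x \<bullet> c + y"
    by (auto simp: max_vertex_def extreme_point_of_prism)
  have "x \<in> P" using x by (simp add: extreme_point_of_def)
  then have "y = 1" using max[of x 1] x(2) by auto
  then show "max_vertex P c x \<and> y = 1"
    using x max[of _ 1] by (auto simp: max_vertex_def)
qed (auto simp: max_vertex_def extreme_point_of_prism intro: add_mono)

text \<open>The minimal vertex of the prism lies at height 0 and the maximal one at height 1, so
  every monotone path has to climb.\<close>

lemma monotone_paths_prism:
  "monotone_paths (P \<times> {0..1::real}) (c, 1) =
    {lift_path k p |k p. p \<in> monotone_paths P c \<and> k < length p}"
proof (intro set_eqI iffI)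
  fix q assume q: "q \<in> monotone_paths (P \<times> {0..1::real}) (c, 1)"
  have "snd (hd q) = 0" "snd (last q) = 1"
    using q min_vertex_prism[of "fst (hd q)" "snd (hd q)"]
      max_vertex_prism[of "fst (last q)" "snd (last q)"]
    by (auto simp: monotone_paths_iff)
  then obtain p k where p: "vwalk p base_graph" "k < length p" "q = lift_path k p"
    using q vwalk_prism_imp_lift_path[of q] by (auto simp: monotone_paths_iff)
  then have "p \<in> monotone_paths P c"
    using q by (auto simp: monotone_paths_iff hd_lift_path last_lift_path
        min_vertex_prism max_vertex_prism)
  then show "q \<in> {lift_path k p |k p. p \<in> monotone_paths P c \<and> k < length p}"
    using p by auto
qed (auto simp: monotone_paths_iff hd_lift_path last_lift_path min_vertex_prism max_vertex_prism
      vwalk_lift_path)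

end

section \<open>Coherent paths on the prism\<close>

definition max_face :: "'a::euclidean_space set \<Rightarrow> 'a \<Rightarrow> 'a set" where
  "max_face P w = {x \<in> P. \<forall>y\<in>P. y \<bullet> w \<le> x \<bullet> w}"

text \<open>Once the maximum is attained, the face is a section by a supporting hyperplane; this
  yields facehood and, in the plane, the bound on the dimension.\<close>

lemma max_face_eq_hyperplane:
  assumes "x \<in> max_face P w"
  shows "max_face P w = P \<inter> {y. w \<bullet> y = w \<bullet> x}"
proof (intro set_eqI iffI)
  fix y assume y: "y \<in> max_face P w"
  then have "y \<bullet> w = x \<bullet> w"
    using assms by (intro antisym) (simp_all add: max_face_def)
  then show "y \<in> P \<inter> {y. w \<bullet> y = w \<bullet> x}"
    using y by (simp add: max_face_def inner_commute[of w])
next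
  fix y assume "y \<in> P \<inter> {y. w \<bullet> y = w \<bullet> x}"
  then show "y \<in> max_face P w"
    using assms by (simp add: max_face_def inner_commute[of w])
qed

lemma max_face_face_of:
  assumes "convex P"
  shows "max_face P w face_of P"
proof (cases "max_face P w = {}")
  case False
  then obtain x where x: "x \<in> max_face P w" by auto
  then have "w \<bullet> y \<le> w \<bullet> x" if "y \<in> P" for y
    using that by (simp add: max_face_def inner_commute[of w])
  then show ?thesis
    unfolding max_face_eq_hyperplane[OF x] using assms
    by (intro face_of_Int_supporting_hyperplane_le)
qed simp

lemma max_face_nonempty:
  assumes "compact P" and "P \<noteq> {}"
  shows "max_face P w \<noteq> {}"
proof -
  have "continuous_on P (\<lambda>x. x \<bullet> w)" by (intro continuous_intros)
  from continuous_attains_sup[OF assms this] show ?thesis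
    by (auto simp: max_face_def)
qed

lemma max_face_scale:
  assumes "r > 0"
  shows "max_face P (r *\<^sub>R w) = max_face P w"
  using assms by (simp add: max_face_def)

text \<open>The functional is a sum of one term per factor, so each coordinate can be maximised
  while the other is fixed.\<close>

lemma max_face_Times: "max_face (A \<times> B) (w, r) = max_face A w \<times> max_face B r"
proof (intro set_eqI iffI)
  fix z assume "z \<in> max_face (A \<times> B) (w, r)"
  then obtain x y where z: "z = (x, y)" "x \<in> A" "y \<in> B"
    and le: "\<And>x' y'. x' \<in> A \<Longrightarrow> y' \<in> B \<Longrightarrow> x' \<bullet> w + y' \<bullet> r \<le> x \<bullet> w + y \<bullet> r"
    by (cases z) (simp add: max_face_def)
  show "z \<in> max_face A w \<times> max_face B r"
    using z le[of _ y] le[of x] by (simp add: max_face_def)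
next
  fix z assume "z \<in> max_face A w \<times> max_face B r"
  then show "z \<in> max_face (A \<times> B) (w, r)"
    by (cases z) (simp add: max_face_def add_mono)
qed

lemma max_face_unit_interval:
  "max_face {0..1::real} r = (if r > 0 then {1} else if r = 0 then {0..1} else {0})"
proof -
  consider "r > 0" | "r = 0" | "r < 0" by linarith
  then show ?thesis
  proof cases
    case 1
    then show ?thesis by (auto simp: max_face_def dest: bspec[of _ _ 1])
  next
    case 3
    then show ?thesis by (auto simp: max_face_def dest: bspec[of _ _ 0])
  qed (auto simp: max_face_def)
qed

text \<open>The functional is affine along the segment, and the sign of its slope selects the face.
  Needed when the polytope is itself an edge of the path.\<close>

lemma max_face_closed_segment:
  "max_face (closed_segment u v) w =
    (if u \<bullet> w < v \<bullet> w then {v} else if u \<bullet> w = v \<bullet> w then closed_segment u v else {u})"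
proof -
  have eq: "((1 - t) *\<^sub>R u + t *\<^sub>R v) \<bullet> w = u \<bullet> w + t * (v \<bullet> w - u \<bullet> w)" for t
    by (simp add: inner_add_left algebra_simps)
  have le: "u \<bullet> w + t * (v \<bullet> w - u \<bullet> w) \<le> v \<bullet> w"
    if "u \<bullet> w \<le> v \<bullet> w" "t \<le> 1" for t
    using mult_right_mono[of t 1 "v \<bullet> w - u \<bullet> w"] that by simp
  have ge: "u \<bullet> w + t * (v \<bullet> w - u \<bullet> w) \<le> u \<bullet> w"
    if "v \<bullet> w \<le> u \<bullet> w" "0 \<le> t" for t
    using mult_nonneg_nonpos[of t "v \<bullet> w - u \<bullet> w"] that by simp
  consider "u \<bullet> w < v \<bullet> w" | "u \<bullet> w = v \<bullet> w" | "v \<bullet> w < u \<bullet> w" by linarith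
  then show ?thesis
  proof cases
    case 1
    have "x = v" if "x \<in> max_face (closed_segment u v) w" for x
    proof -
      have "x \<in> closed_segment u v" using that by (simp add: max_face_def)
      then obtain t where t: "t \<le> 1" "x = (1 - t) *\<^sub>R u + t *\<^sub>R v"
        by (auto simp: in_segment)
      have "v \<bullet> w \<le> x \<bullet> w" using that by (auto simp: max_face_def)
      then have "(1 - t) * (v \<bullet> w - u \<bullet> w) \<le> 0" unfolding t eq by (simp add: algebra_simps)
      then have "t = 1" using 1 t(1) by (auto simp: mult_le_0_iff)
      then show ?thesis using t by simp
    qed
    moreover have "y \<bullet> w \<le> v \<bullet> w" if "y \<in> closed_segment u v" for y
      using that 1 le by (auto simp: in_segment eq)
    then have "v \<in> max_face (closed_segment u v) w" by (simp add: max_face_def)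
    ultimately show ?thesis using 1 by auto
  next
    case 2
    then show ?thesis by (auto simp: max_face_def in_segment eq)
  next
    case 3
    have "x = u" if "x \<in> max_face (closed_segment u v) w" for x
    proof -
      have "x \<in> closed_segment u v" using that by (simp add: max_face_def)
      then obtain t where t: "0 \<le> t" "x = (1 - t) *\<^sub>R u + t *\<^sub>R v"
        by (auto simp: in_segment)
      have "u \<bullet> w \<le> x \<bullet> w" using that by (auto simp: max_face_def)
      then have "t * (v \<bullet> w - u \<bullet> w) \<ge> 0" unfolding t eq by simp
      then have "t = 0" using 3 t(1) by (auto simp: zero_le_mult_iff)
      then show ?thesis using t by simp
    qed
    moreover have "y \<bullet> w \<le> u \<bullet> w" if "y \<in> closed_segment u v" for y
      using that 3 ge by (auto simp: in_segment eq)
    then have "u \<in> max_face (closed_segment u v) w" by (simp add: max_face_def)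
    ultimately show ?thesis using 3 by auto
  qed
qed

text \<open>For small \<open>r\<close> the vertices outside the old face stay below \<open>q\<close>
  by continuity, and those on it fall below because of \<open>d\<close>. Only finitely many vertices
  compete, so one \<open>r\<close> serves all.\<close>

lemma max_face_perturb:
  assumes P: "polytope P" and q: "q \<in> max_face P w"
    and uniq: "\<And>y. y \<in> max_face P w \<Longrightarrow> y \<noteq> q \<Longrightarrow> y \<bullet> d < q \<bullet> d"
  shows "\<exists>r>0. max_face P (w + r *\<^sub>R d) = {q}"
proof -
  let ?V = "{v. v extreme_point_of P} - {q}"
  have fin: "finite ?V"
    using P finite_polyhedron_extreme_points polytope_imp_polyhedron by blast
  have "\<forall>\<^sub>F r in at_right 0. v \<bullet> (w + r *\<^sub>R d) < q \<bullet> (w + r *\<^sub>R d)" if v: "v \<in> ?V" for v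
  proof (cases "v \<in> max_face P w")
    case True
    then have "v \<bullet> w = q \<bullet> w" "v \<bullet> d < q \<bullet> d"
      using q uniq v by (auto simp: max_face_def intro: antisym)
    then show ?thesis
      unfolding eventually_at_right_field by (intro exI[of _ 1]) (auto simp: inner_add_right)
  next
    case False
    have "v \<in> P" using v by (auto simp: extreme_point_of_def)
    then have less: "v \<bullet> w < q \<bullet> w"
      using False q by (force simp: max_face_def not_le intro: less_le_trans)
    have "((\<lambda>r. q \<bullet> (w + r *\<^sub>R d) - v \<bullet> (w + r *\<^sub>R d)) \<longlongrightarrow>
        q \<bullet> (w + 0 *\<^sub>R d) - v \<bullet> (w + 0 *\<^sub>R d)) (at_right 0)"
      by (intro tendsto_intros)
    then have "\<forall>\<^sub>F r in at_right 0. 0 < q \<bullet> (w + r *\<^sub>R d) - v \<bullet> (w + r *\<^sub>R d)"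
      by (rule order_tendstoD) (use less in simp)
    then show ?thesis by simp
  qed
  then have "\<forall>\<^sub>F r in at_right 0. \<forall>v\<in>?V. v \<bullet> (w + r *\<^sub>R d) < q \<bullet> (w + r *\<^sub>R d)"
    using fin by (simp add: eventually_ball_finite_distrib)
  moreover have "\<forall>\<^sub>F r::real in at_right 0. r > 0"
    by (rule eventually_at_right_less)
  ultimately have "\<forall>\<^sub>F r::real in at_right 0.
      r > 0 \<and> (\<forall>v\<in>?V. v \<bullet> (w + r *\<^sub>R d) < q \<bullet> (w + r *\<^sub>R d))"
    by eventually_elim auto
  then obtain r :: real where r: "r > 0" "\<forall>v\<in>?V. v \<bullet> (w + r *\<^sub>R d) < q \<bullet> (w + r *\<^sub>R d)"
    using eventually_happens trivial_limit_at_right_real by blast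
  let ?M = "max_face P (w + r *\<^sub>R d)"
  have cp: "compact P" "convex P" and qP: "q \<in> P"
    using P q polytope_imp_compact polytope_imp_convex by (auto simp: max_face_def)
  have face: "?M face_of P" using cp by (intro max_face_face_of)
  \<comment> \<open>A compact convex face is the hull of its extreme points, so it suffices to
    exclude extreme points other than \<open>q\<close>.\<close>
  then have M: "?M = convex hull {x. x extreme_point_of ?M}"
    using cp by (intro Krein_Milman_Minkowski) (auto intro: face_of_imp_compact face_of_imp_convex)
  have "v = q" if "v extreme_point_of ?M" for v
  proof (rule ccontr)
    assume "v \<noteq> q"
    have "v extreme_point_of P" "v \<in> ?M" using that extreme_point_of_face[OF face] by auto
    then have "v \<bullet> (w + r *\<^sub>R d) < q \<bullet> (w + r *\<^sub>R d)" "q \<bullet> (w + r *\<^sub>R d) \<le> v \<bullet> (w + r *\<^sub>R d)"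
      using r(2) \<open>v \<noteq> q\<close> qP by (blast, simp add: max_face_def)
    then show False by simp
  qed
  then have "{x. x extreme_point_of ?M} \<subseteq> {q}" by auto
  then have "?M \<subseteq> convex hull {q}"
    using M hull_mono[of "{x. x extreme_point_of ?M}" "{q}" convex] by simp
  moreover have "?M \<noteq> {}" using cp qP by (intro max_face_nonempty) auto
  ultimately have "?M = {q}" by auto
  then show ?thesis using r(1) by auto
qed

text \<open>A nonzero normal confines the face to a line, which leaves only dimensions 0 and 1. The
  polygon may be degenerate, and then the edge can be \<open>Q\<close> itself.\<close>

lemma max_face_vertex_or_edge:
  fixes Q :: "(real \<times> real) set"
  assumes "polytope Q" and "Q \<noteq> {}" and "n \<noteq> 0"
  shows "(\<exists>q. q extreme_point_of Q \<and> max_face Q n = {q}) \<or> max_face Q n edge_of Q"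
proof -
  have cp: "compact Q" "convex Q"
    using assms(1) polytope_imp_compact polytope_imp_convex by auto
  have face: "max_face Q n face_of Q" using cp(2) by (rule max_face_face_of)
  obtain x where x: "x \<in> max_face Q n" using max_face_nonempty[OF cp(1) assms(2)] by blast
  have "aff_dim (max_face Q n) \<le> aff_dim {y. n \<bullet> y = n \<bullet> x}"
    unfolding max_face_eq_hyperplane[OF x] by (intro aff_dim_subset) auto
  also have "\<dots> = 1" using assms(3) by (simp add: aff_dim_hyperplane)
  finally have "aff_dim (max_face Q n) \<le> 1" .
  moreover have "aff_dim (max_face Q n) \<ge> 0"
    using x by (metis aff_dim_negative_iff empty_iff not_less)
  ultimately consider "aff_dim (max_face Q n) = 0" | "aff_dim (max_face Q n) = 1" by linarith
  then show ?thesis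
  proof cases
    case 1
    then obtain q where "max_face Q n = {q}" by (auto simp: aff_dim_eq_0)
    then show ?thesis using face face_of_singleton by metis
  next
    case 2
    then show ?thesis using face by (simp add: edge_of_def)
  qed
qed

text \<open>An end point of an upper edge becomes the only maximiser once the normal of that edge is tilted
  slightly, so vertices need no separate treatment.\<close>

lemma upper_faces_eq:
  fixes Q :: "(real \<times> real) set"
  assumes "polytope Q" and "Q \<noteq> {}"
  shows "upper_faces Q = range (\<lambda>s. max_face Q (- s, 1))"
proof (intro set_eqI iffI)
  fix F assume "F \<in> range (\<lambda>s. max_face Q (- s, 1))"
  then obtain s where F: "F = max_face Q (- s, 1)" by auto
  have "(\<exists>q. q extreme_point_of Q \<and> F = {q}) \<or> F edge_of Q"
    unfolding F by (rule max_face_vertex_or_edge[OF assms]) (simp add: zero_prod_def)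
  moreover have "\<forall>q\<in>F. \<forall>y\<in>Q. y \<bullet> (- s, 1) \<le> q \<bullet> (- s, 1)"
    unfolding F by (simp add: max_face_def)
  ultimately show "F \<in> upper_faces Q"
    unfolding upper_faces_def by (force intro!: exI[of _ "(- s, 1)"])
next
  fix F assume F: "F \<in> upper_faces Q"
  then obtain n where n: "snd n > 0" "\<forall>q\<in>F. \<forall>y\<in>Q. y \<bullet> n \<le> q \<bullet> n"
    and ve: "(\<exists>q. q extreme_point_of Q \<and> F = {q}) \<or> F edge_of Q"
    unfolding upper_faces_def by auto
  \<comment> \<open>Rescaling by \<open>snd n > 0\<close> normalises the second coordinate of the
    normal to 1.\<close>
  define s where "s = - fst n / snd n"
  have "n = snd n *\<^sub>R (- s, 1)" using n(1) by (simp add: s_def prod_eq_iff)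
  then have M: "max_face Q n = max_face Q (- s, 1)"
    using max_face_scale[OF n(1), of Q "(- s, 1)"] by simp
  have FQ: "F \<subseteq> Q"
    using ve by (auto simp: extreme_point_of_def dest: edge_of_imp_subset)
  then have FM: "F \<subseteq> max_face Q (- s, 1)"
    unfolding M[symmetric] using n(2) by (auto simp: max_face_def)
  from ve show "F \<in> range (\<lambda>s. max_face Q (- s, 1))"
  proof
    assume "F edge_of Q"
    then have F: "F face_of Q" "aff_dim F = 1" by (auto simp: edge_of_def)
    let ?M = "max_face Q (- s, 1)"
    have conv: "convex Q" using assms(1) polytope_imp_convex by auto
    have "F face_of ?M"
      by (rule face_of_subset[OF F(1) FM]) (auto simp: max_face_def)
    moreover have "aff_dim ?M \<le> 1"
      using max_face_vertex_or_edge[OF assms, of "(- s, 1)"]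
      by (auto simp: edge_of_def zero_prod_def)
    moreover have "convex ?M"
      using max_face_face_of[OF conv] face_of_imp_convex by blast
    \<comment> \<open>A proper face of the at most one-dimensional \<open>?M\<close> would have
      dimension below 1.\<close>
    ultimately have "F = ?M"
      using F(2) face_of_aff_dim_lt[of ?M F] by fastforce
    then show ?thesis by blast
  next
    assume "\<exists>q. q extreme_point_of Q \<and> F = {q}"
    then obtain q where q: "q extreme_point_of Q" "F = {q}" by auto
    let ?M = "max_face Q (- s, 1)"
    have qM: "q \<in> ?M" using FM q by auto
    have line: "snd y = snd q + s * (fst y - fst q)" if "y \<in> ?M" for y
      using that unfolding max_face_eq_hyperplane[OF qM]
      by (cases y; cases q) (auto simp: algebra_simps)
    \<comment> \<open>Tilt to either side: if neither \<open>d = 1\<close> nor \<open>d = -1\<close>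
      singles out \<open>q\<close>, then \<open>q\<close> lies strictly between two points of
      \<open>?M\<close>, against extremality.\<close>
    have "\<exists>d::real. \<forall>y\<in>?M. y \<noteq> q \<longrightarrow> y \<bullet> (d, 0) < q \<bullet> (d, 0)"
    proof (rule ccontr)
      assume neg: "\<nexists>d::real. \<forall>y\<in>?M. y \<noteq> q \<longrightarrow> y \<bullet> (d, 0) < q \<bullet> (d, 0)"
      obtain a where a: "a \<in> ?M" "a \<noteq> q" "fst q \<le> fst a"
        using neg[unfolded not_ex, rule_format, of 1] by (auto simp: inner_prod_def not_less)
      obtain b where b: "b \<in> ?M" "b \<noteq> q" "fst b \<le> fst q"
        using neg[unfolded not_ex, rule_format, of "-1"] by (auto simp: inner_prod_def not_less)
      \<comment> \<open>On the non-vertical line, equal first coordinates would force equal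
        points.\<close>
      have ab: "fst b < fst q" "fst q < fst a"
        using a b line[OF a(1)] line[OF b(1)] by (auto simp: prod_eq_iff order_less_le)
      define t where "t = (fst q - fst b) / (fst a - fst b)"
      have t: "0 < t" "t < 1" using ab by (auto simp: t_def)
      have teq: "t * (fst a - fst b) = fst q - fst b" using ab by (simp add: t_def)
      have "fst q = (1 - t) * fst b + t * fst a" using teq by (simp add: algebra_simps)
      moreover have "snd q = (1 - t) * snd b + t * snd a"
      proof -
        have "(1 - t) * snd b + t * snd a = snd q + s * (fst b - fst q + t * (fst a - fst b))"
          unfolding line[OF a(1)] line[OF b(1)] by (simp add: algebra_simps)
        then show ?thesis unfolding teq by simp
      qed
      ultimately have "q = (1 - t) *\<^sub>R b + t *\<^sub>R a"
        by (simp add: prod_eq_iff)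
      then have "q \<in> open_segment b a"
        using t ab by (auto simp: in_segment)
      then show False
        using q(1) a(1) b(1) by (auto simp: extreme_point_of_def max_face_def)
    qed
    then obtain d :: real where "\<And>y. y \<in> ?M \<Longrightarrow> y \<noteq> q \<Longrightarrow> y \<bullet> (d, 0) < q \<bullet> (d, 0)" by blast
    from max_face_perturb[OF assms(1) qM this] obtain r
      where "max_face Q ((- s, 1) + r *\<^sub>R (d, 0)) = {q}" by blast
    \<comment> \<open>A horizontal tilt of the normal only changes the parameter, from
      \<open>s\<close> to \<open>s - r * d\<close>.\<close>
    then have "F = max_face Q (- (s - r * d), 1)" using q(2) by simp
    then show ?thesis by blast
  qed
qed

text \<open>Pulling the normal \<open>(- s, 1)\<close> back along the shadow map gives
  \<open>\<omega> - s *\<^sub>R c\<close>, which moves the whole condition from the polygon to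
  \<open>P\<close>.\<close>

lemma coherent_iff_max_face:
  assumes "polytope P" and "P \<noteq> {}"
  shows "coherent P c p \<longleftrightarrow> (\<exists>\<omega>. \<omega> \<noteq> c \<and> independent {c, \<omega>} \<and>
    path_faces p = range (\<lambda>s. max_face P (\<omega> - s *\<^sub>R c)))"
proof -
  have "(\<lambda>F. {x \<in> P. shadow_map c \<omega> x \<in> F}) ` upper_faces (shadow_map c \<omega> ` P) =
      range (\<lambda>s. max_face P (\<omega> - s *\<^sub>R c))" for \<omega>
  proof -
    have "linear (shadow_map c \<omega>)"
      by (rule linearI) (auto simp: shadow_map_def inner_add_left)
    then have "polytope (shadow_map c \<omega> ` P)"
      using assms(1) polytope_linear_image by blast
    moreover have "shadow_map c \<omega> x \<bullet> (- s, 1) = x \<bullet> (\<omega> - s *\<^sub>R c)" for x s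
      by (simp add: shadow_map_def inner_diff_right)
    then have "{x \<in> P. shadow_map c \<omega> x \<in> max_face (shadow_map c \<omega> ` P) (- s, 1)} =
        max_face P (\<omega> - s *\<^sub>R c)" for s
      by (auto simp: max_face_def)
    ultimately show ?thesis
      using assms(2) by (simp add: upper_faces_eq image_image)
  qed
  then show ?thesis unfolding coherent_def by simp
qed

section \<open>Faces along a path\<close>

lemma path_faces_append:
  "path_faces (xs @ v # ys) = path_faces (xs @ [v]) \<union> path_faces (v # ys)"
proof (cases xs)
  case Nil
  then show ?thesis by (auto simp: path_faces_def)
next
  case (Cons x xs')
  then have "vwalk_arcs (xs @ v # ys) = vwalk_arcs (xs @ [v]) @ vwalk_arcs (v # ys)"
    by (simp add: vwalk_arcs_append del: vwalk_arcs_Cons append_Cons)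
  then show ?thesis by (auto simp: path_faces_def)
qed

lemma vwalk_arcs_map: "vwalk_arcs (map f p) = map (map_prod f f) (vwalk_arcs p)"
  by (induction p rule: vwalk_arcs.induct) auto

lemma path_faces_level:
  "path_faces (map (\<lambda>v. (v, a)) p) = (\<lambda>F. F \<times> {a}) ` path_faces p"
  by (simp add: path_faces_def vwalk_arcs_map closed_segment_horizontal image_Un image_image
      case_prod_beta)

text \<open>The arc between the two copies of \<open>v\<close> contributes the vertical edge; every
  other face stays at one height.\<close>

lemma path_faces_lift_path:
  "path_faces (lift_path (length xs) (xs @ v # ys)) =
    (\<lambda>F. F \<times> {0}) ` path_faces (xs @ [v]) \<union> {{v} \<times> {0..1}} \<union>
    (\<lambda>F. F \<times> {1}) ` path_faces (v # ys)"
proof -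
  let ?l = "map (\<lambda>v. (v, 0::real)) (xs @ [v])" and ?u = "map (\<lambda>v. (v, 1::real)) (v # ys)"
  have "path_faces (?l @ ?u) = path_faces ?l \<union> {closed_segment (v, 0) (v, 1)} \<union> path_faces ?u"
    unfolding path_faces_def by (subst vwalk_arcs_append) auto
  then show ?thesis
    unfolding lift_path_append path_faces_level
    by (simp add: closed_segment_vertical closed_segment_eq_real_ivl)
qed

lemma vwalk_arcs_subset: "(a, b) \<in> set (vwalk_arcs p) \<Longrightarrow> a \<in> set p \<and> b \<in> set p"
  by (induction p rule: vwalk_arcs.induct) auto

lemma distinct_vwalk_arcs: "distinct p \<Longrightarrow> (a, b) \<in> set (vwalk_arcs p) \<Longrightarrow> a \<noteq> b"
  by (induction p rule: vwalk_arcs.induct) auto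

lemma path_faces_other_vertex:
  assumes "F \<in> path_faces p" and "distinct p" and "F \<noteq> {v}"
  shows "\<exists>u\<in>F. u \<in> set p \<and> u \<noteq> v"
proof -
  from assms(1) consider x where "x \<in> set p" "F = {x}"
    | a b where "(a, b) \<in> set (vwalk_arcs p)" "F = closed_segment a b"
    by (auto simp: path_faces_def)
  then show ?thesis
  proof cases
    case 2
    then show ?thesis
      using vwalk_arcs_subset[OF 2(1)] distinct_vwalk_arcs[OF assms(2) 2(1)]
      by (metis ends_in_segment)
  qed (use assms(3) in auto)
qed

text \<open>Tilting the functional in direction \<open>d\<close> moves the maximiser towards larger values of \<open>d\<close>.
  Here \<open>A\<close> and \<open>B\<close> are the faces of the path on the two sides of \<open>v\<close>.\<close>

lemma max_face_tilt_image:
  assumes P: "polytope P" and v: "max_face P w = {v}"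
    and range: "range (\<lambda>r. max_face P (w + r *\<^sub>R d)) = A \<union> B"
    and A: "\<And>F. F \<in> A \<Longrightarrow> F \<noteq> {v} \<Longrightarrow> \<exists>u\<in>F. u \<bullet> d < v \<bullet> d"
    and B: "\<And>F. F \<in> B \<Longrightarrow> F \<noteq> {v} \<Longrightarrow> \<exists>u\<in>F. v \<bullet> d < u \<bullet> d"
    and vB: "{v} \<in> B"
  shows "(\<lambda>r. max_face P (w + r *\<^sub>R d)) ` {0<..} = B"
proof (intro set_eqI iffI)
  have vP: "v \<in> P" "\<And>x. x \<in> P \<Longrightarrow> x \<bullet> w \<le> v \<bullet> w"
    using v by (auto simp: max_face_def)
  fix F assume "F \<in> (\<lambda>r. max_face P (w + r *\<^sub>R d)) ` {0<..}"
  then obtain r where r: "r > 0" "F = max_face P (w + r *\<^sub>R d)" by auto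
  \<comment> \<open>Optimality of \<open>x\<close> after the tilt and of \<open>v\<close> before it
    combine into this bound, which excludes the faces of \<open>A\<close> other than
    \<open>{v}\<close>.\<close>
  have ge: "v \<bullet> d \<le> x \<bullet> d" if "x \<in> F" for x
  proof -
    have "v \<bullet> (w + r *\<^sub>R d) \<le> x \<bullet> (w + r *\<^sub>R d)" "x \<in> P"
      using that vP r(2) by (auto simp: max_face_def)
    then have "r * (v \<bullet> d) \<le> r * (x \<bullet> d)"
      using vP(2)[of x] by (simp add: inner_add_right)
    then show ?thesis using r(1) by simp
  qed
  have "F \<in> A \<union> B" using range r(2) by blast
  then show "F \<in> B"
  proof
    assume "F \<in> A"
    then have "F = {v}" using A[of F] ge by force
    then show ?thesis using vB by simp
  qed
next
  have vP: "v \<in> P" "\<And>x. x \<in> P \<Longrightarrow> x \<bullet> w \<le> v \<bullet> w"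
    using v by (auto simp: max_face_def)
  fix F assume F: "F \<in> B"
  show "F \<in> (\<lambda>r. max_face P (w + r *\<^sub>R d)) ` {0<..}"
  proof (cases "F = {v}")
    case True
    \<comment> \<open>As \<open>v\<close> is the only maximiser, a small tilt keeps it.\<close>
    obtain r where "r > 0" "max_face P (w + r *\<^sub>R d) = {v}"
      using max_face_perturb[OF P, of v w d] v by auto
    then show ?thesis using True by auto
  next
    case False
    then obtain u where u: "u \<in> F" "v \<bullet> d < u \<bullet> d" using B F by blast
    obtain r where r: "F = max_face P (w + r *\<^sub>R d)" using range F by blast
    \<comment> \<open>The same comparison forces \<open>r \<ge> 0\<close>, and \<open>r = 0\<close>
      would give \<open>{v}\<close>.\<close>
    have "v \<bullet> (w + r *\<^sub>R d) \<le> u \<bullet> (w + r *\<^sub>R d)" "u \<in> P"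
      using u vP r by (auto simp: max_face_def)
    then have "0 \<le> r * (u \<bullet> d - v \<bullet> d)"
      using vP(2)[of u] by (simp add: inner_add_right algebra_simps)
    then have "r \<ge> 0" using u(2) by (simp add: zero_le_mult_iff)
    moreover have "r \<noteq> 0"
    proof
      assume "r = 0"
      then show False using False r v by simp
    qed
    ultimately have "r \<in> {0<..}" by simp
    then show ?thesis using r by blast
  qed
qed

text \<open>The functional has vertical component \<open>t - s\<close>, whose sign selects the top,
  the whole interval or the bottom.\<close>

lemma max_face_prism:
  "max_face (P \<times> {0..1::real}) ((\<omega>, t) - s *\<^sub>R (c, 1)) =
    max_face P (\<omega> - s *\<^sub>R c) \<times> (if s < t then {1} else if s = t then {0..1} else {0})"
  by (simp add: max_face_Times max_face_unit_interval)

text \<open>The span form is the one that is easy to check on the prism and in the degenerate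
  ambient spaces.\<close>

lemma independent_pair_iff:
  fixes c :: "'a::real_vector"
  shows "\<omega> \<noteq> c \<and> independent {c, \<omega>} \<longleftrightarrow> c \<noteq> 0 \<and> \<omega> \<notin> span {c}"
proof -
  have "independent (insert \<omega> {c}) \<longleftrightarrow>
      (if \<omega> \<in> {c} then independent {c} else independent {c} \<and> \<omega> \<notin> span {c})"
    by (rule independent_insert)
  then show ?thesis
    by (auto simp: insert_commute span_base)
qed

section \<open>Coherence of lifted paths and the degenerate ambient spaces\<close>

context
  fixes P :: "'a::euclidean_space set" and c :: 'a
  assumes polytope: "polytope P"
begin

lemma polytope_prism: "polytope (P \<times> {0..1::real})"
proof -
  have "polytope {0..1::real}"
    using polytope_interval[of 0 "1::real"] by simp
  then show ?thesis using polytope by (simp add: polytope_Times)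
qed

lemma monotone_path_nonempty:
  assumes "p \<in> monotone_paths P c"
  shows "P \<noteq> {}"
  using assms by (auto simp: monotone_paths_iff min_vertex_def extreme_point_of_def)

text \<open>If \<open>\<omega>\<close> is a multiple of \<open>c\<close>, then \<open>P\<close> itself is one of the maximal faces, hence a point or an
  edge of the path; for such \<open>P\<close> the faces do not depend on \<open>\<omega>\<close>.\<close>

lemma coherentI:
  assumes p: "p \<in> monotone_paths P c" and ind: "c \<noteq> 0" "\<omega>' \<notin> span {c}"
    and pf: "path_faces p = range (\<lambda>s. max_face P (\<omega> - s *\<^sub>R c))"
  shows "coherent P c p"
proof -
  note coh = coherent_iff_max_face[OF polytope monotone_path_nonempty[OF p], of c p,
      folded conj_assoc, unfolded independent_pair_iff]
  show ?thesis
  proof (cases "\<omega> \<in> span {c}")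
    case False
    then show ?thesis using coh ind(1) pf by blast
  next
    case True
    then obtain a where "\<omega> = a *\<^sub>R c" by (auto simp: span_singleton)
    \<comment> \<open>At \<open>s = a\<close> the functional vanishes, so every point of
      \<open>P\<close> is a maximiser.\<close>
    then have "max_face P (\<omega> - a *\<^sub>R c) = P" by (simp add: max_face_def)
    then have "P \<in> path_faces p" unfolding pf by (metis rangeI)
    then consider x where "P = {x}"
      | u v where "(u, v) \<in> set (vwalk_arcs p)" "P = closed_segment u v"
      by (auto simp: path_faces_def)
    then have "range (\<lambda>s. max_face P (\<omega> - s *\<^sub>R c)) = range (\<lambda>s. max_face P (\<omega>' - s *\<^sub>R c))"
    proof cases
      case 1
      then show ?thesis by (auto simp: max_face_def)
    next
      case 2
      have "u \<bullet> c < v \<bullet> c"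
        using p 2(1) by (auto simp: monotone_paths_iff vwalk_def parcs_polytope_digraph)
      have "range (\<lambda>s. max_face P (\<nu> - s *\<^sub>R c)) = {{u}, {v}, P}" for \<nu>
      proof -
        \<comment> \<open>\<open>s0\<close> is the parameter at which the two ends of the segment
          tie.\<close>
        define s0 where "s0 = ((v - u) \<bullet> \<nu>) / ((v - u) \<bullet> c)"
        have pos: "(v - u) \<bullet> c > 0" using \<open>u \<bullet> c < v \<bullet> c\<close> by (simp add: inner_diff_left)
        have sgn: "v \<bullet> (\<nu> - s *\<^sub>R c) - u \<bullet> (\<nu> - s *\<^sub>R c) = (s0 - s) * ((v - u) \<bullet> c)" for s
          using pos by (simp add: s0_def inner_diff_left inner_diff_right field_simps)
        have lt: "u \<bullet> (\<nu> - s *\<^sub>R c) < v \<bullet> (\<nu> - s *\<^sub>R c) \<longleftrightarrow> s < s0" for s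
        proof -
          have "u \<bullet> (\<nu> - s *\<^sub>R c) < v \<bullet> (\<nu> - s *\<^sub>R c) \<longleftrightarrow> 0 < (s0 - s) * ((v - u) \<bullet> c)"
            unfolding sgn[symmetric] by simp
          then show ?thesis using pos by (simp add: zero_less_mult_iff)
        qed
        have eq: "u \<bullet> (\<nu> - s *\<^sub>R c) = v \<bullet> (\<nu> - s *\<^sub>R c) \<longleftrightarrow> s = s0" for s
        proof -
          have "u \<bullet> (\<nu> - s *\<^sub>R c) = v \<bullet> (\<nu> - s *\<^sub>R c) \<longleftrightarrow> 0 = (s0 - s) * ((v - u) \<bullet> c)"
            unfolding sgn[symmetric] by auto
          then show ?thesis using pos by auto
        qed
        have "max_face P (\<nu> - s *\<^sub>R c) = (if s < s0 then {v} else if s = s0 then P else {u})" for s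
          unfolding 2(2) max_face_closed_segment lt eq ..
        then have M: "(\<lambda>s. max_face P (\<nu> - s *\<^sub>R c)) =
            (\<lambda>s. if s < s0 then {v} else if s = s0 then P else {u})"
          by auto
        have "{v} \<in> range (\<lambda>s. if s < s0 then {v} else if s = s0 then P else {u})"
          by (rule range_eqI[of _ _ "s0 - 1"]) simp
        moreover have "P \<in> range (\<lambda>s. if s < s0 then {v} else if s = s0 then P else {u})"
          by (rule range_eqI[of _ _ s0]) simp
        moreover have "{u} \<in> range (\<lambda>s. if s < s0 then {v} else if s = s0 then P else {u})"
          by (rule range_eqI[of _ _ "s0 + 1"]) simp
        ultimately show ?thesis unfolding M by (auto split: if_splits)
      qed
      then show ?thesis by simp
    qed
    then show ?thesis using coh ind pf by metis
  qed
qed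

text \<open>Both directions read off the maximal faces of the prism from those of \<open>P\<close>.
  The vector \<open>\<omega>0\<close> records that \<open>c\<close> does not span the ambient
  space.\<close>

lemma coherent_lift_path_iff:
  assumes p: "p \<in> monotone_paths P c" and k: "k < length p"
    and ind: "c \<noteq> 0" "\<omega>0 \<notin> span {c}"
  shows "coherent (P \<times> {0..1::real}) (c, 1) (lift_path k p) \<longleftrightarrow> coherent P c p"
proof -
  define xs v ys where "xs = take k p" and "v = p ! k" and "ys = drop (Suc k) p"
  have p_eq: "p = xs @ v # ys" and k_eq: "k = length xs"
    using k by (simp_all add: xs_def v_def ys_def id_take_nth_drop)
  have ne: "P \<noteq> {}" using monotone_path_nonempty[OF p] .
  then have ne': "P \<times> {0..1::real} \<noteq> {}" by auto
  let ?M = "\<lambda>\<omega> s. max_face P (\<omega> - s *\<^sub>R c)"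
  have pf': "path_faces (lift_path k p) =
    (\<lambda>F. F \<times> {0}) ` path_faces (xs @ [v]) \<union> {{v} \<times> {0..1}} \<union> (\<lambda>F. F \<times> {1}) ` path_faces (v # ys)"
    unfolding p_eq k_eq by (rule path_faces_lift_path)
  have pf: "path_faces p = path_faces (xs @ [v]) \<union> path_faces (v # ys)"
    unfolding p_eq by (rule path_faces_append)
  have v_in: "{v} \<in> path_faces (xs @ [v])" "{v} \<in> path_faces (v # ys)"
    by (auto simp: path_faces_def)
  show ?thesis
  proof
    assume "coherent (P \<times> {0..1::real}) (c, 1) (lift_path k p)"
    then obtain \<omega> t where \<omega>: "path_faces (lift_path k p) =
        range (\<lambda>s. max_face (P \<times> {0..1::real}) ((\<omega>, t) - s *\<^sub>R (c, 1)))"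
      unfolding coherent_iff_max_face[OF polytope_prism ne'] by auto
    \<comment> \<open>Projection forgets heights: each maximal face of the prism goes to the face of
      \<open>P\<close> with the same \<open>s\<close>.\<close>
    have "(`) fst ` path_faces (lift_path k p) = path_faces p"
      unfolding pf' pf using v_in by (auto simp: image_Un image_image)
    moreover have "(`) fst ` path_faces (lift_path k p) = range (?M \<omega>)"
      unfolding \<omega> max_face_prism by (simp add: image_image)
    ultimately have "path_faces p = range (?M \<omega>)" by simp
    \<comment> \<open>Here \<open>\<omega>\<close> may be a multiple of \<open>c\<close> although
      \<open>(\<omega>, t)\<close> is independent of \<open>(c, 1)\<close>; \<open>coherentI\<close>
      covers this.\<close>
    then show "coherent P c p" by (rule coherentI[OF p ind])
  next
    assume "coherent P c p"
    then obtain \<omega> where \<omega>: "\<omega> \<notin> span {c}" and rg: "path_faces p = range (?M \<omega>)"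
      unfolding coherent_iff_max_face[OF polytope ne] conj_assoc[symmetric] independent_pair_iff
      by auto
    have "{v} \<in> range (?M \<omega>)" using v_in rg pf by blast
    then obtain t where "{v} = ?M \<omega> t" by (rule rangeE)
    then have t: "?M \<omega> t = {v}" ..
    have sorted: "sorted_wrt (\<lambda>u v. u \<bullet> c < v \<bullet> c) (xs @ v # ys)"
      using p sorted_wrt_vwalk unfolding p_eq monotone_paths_iff by blast
    have dist: "distinct (xs @ v # ys)"
      using p unfolding p_eq monotone_paths_def vpath_def by blast
    have lower: "\<exists>u\<in>F. u \<bullet> c < v \<bullet> c" if "F \<in> path_faces (xs @ [v])" "F \<noteq> {v}" for F
      using path_faces_other_vertex[OF that(1) _ that(2)] sorted dist
      by (auto simp: sorted_wrt_append)
    have upper: "\<exists>u\<in>F. v \<bullet> c < u \<bullet> c" if "F \<in> path_faces (v # ys)" "F \<noteq> {v}" for F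
      using path_faces_other_vertex[OF that(1) _ that(2)] sorted dist
      by (auto simp: sorted_wrt_append)
    have surj: "range (\<lambda>r. ?M \<omega> (t - r)) = range (?M \<omega>)" "range (\<lambda>r. ?M \<omega> (t + r)) = range (?M \<omega>)"
      using range_composition[of "?M \<omega>" "\<lambda>r. t - r"] range_composition[of "?M \<omega>" "\<lambda>r. t + r"]
        surjI[of "\<lambda>r. t - r" "\<lambda>s. t - s"] surjI[of "\<lambda>r. t + r" "\<lambda>s. s - t"] by simp_all
    \<comment> \<open>Tilting by \<open>r > 0\<close> towards \<open>c\<close> means
      \<open>s = t - r < t\<close>, which sweeps out the part of the path from \<open>v\<close>
      on.\<close>
    have "(\<lambda>r. max_face P ((\<omega> - t *\<^sub>R c) + r *\<^sub>R c)) ` {0<..} = path_faces (v # ys)"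
      using rg pf surj(1) lower upper v_in
      by (intro max_face_tilt_image[OF polytope t, of c "path_faces (xs @ [v])"])
        (auto simp: algebra_simps)
    moreover have "(\<lambda>r. max_face P ((\<omega> - t *\<^sub>R c) + r *\<^sub>R c)) ` {0<..} = ?M \<omega> ` {..<t}"
    proof -
      have "{..<t} = (\<lambda>r. t - r) ` {0<..}" 
      proof (intro set_eqI iffI)
        fix s assume "s \<in> {..<t}"
        then show "s \<in> (\<lambda>r. t - r) ` {0<..}" by (intro image_eqI[of _ _ "t - s"]) auto
      qed auto
      then show ?thesis by (simp add: image_image algebra_simps)
    qed
    ultimately have top: "?M \<omega> ` {..<t} = path_faces (v # ys)" by simp
    \<comment> \<open>With direction \<open>- c\<close> the two sides of \<open>v\<close> change
      roles.\<close>
    have "(\<lambda>r. max_face P ((\<omega> - t *\<^sub>R c) + r *\<^sub>R (- c))) ` {0<..} = path_faces (xs @ [v])"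
      using rg pf surj(2) lower upper v_in
      by (intro max_face_tilt_image[OF polytope t, of "- c" "path_faces (v # ys)"])
        (auto simp: algebra_simps)
    moreover have "(\<lambda>r. max_face P ((\<omega> - t *\<^sub>R c) + r *\<^sub>R (- c))) ` {0<..} = ?M \<omega> ` {t<..}"
    proof -
      have "{t<..} = (\<lambda>r. t + r) ` {0<..}" 
      proof (intro set_eqI iffI)
        fix s assume "s \<in> {t<..}"
        then show "s \<in> (\<lambda>r. t + r) ` {0<..}" by (intro image_eqI[of _ _ "s - t"]) auto
      qed auto
      then show ?thesis by (simp add: image_image algebra_simps)
    qed
    ultimately have bot: "?M \<omega> ` {t<..} = path_faces (xs @ [v])" by simp
    have U: "UNIV = {t<..} \<union> {t} \<union> {..<t}" by auto
    have "range (\<lambda>s. max_face (P \<times> {0..1::real}) ((\<omega>, t) - s *\<^sub>R (c, 1))) =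
        (\<lambda>s. ?M \<omega> s \<times> {0}) ` {t<..} \<union> {?M \<omega> t \<times> {0..1}} \<union> (\<lambda>s. ?M \<omega> s \<times> {1}) ` {..<t}"
      unfolding max_face_prism by (subst U) (auto simp: image_Un)
    also have "\<dots> = path_faces (lift_path k p)"
      unfolding pf' t top[symmetric] bot[symmetric] by (simp add: image_image)
    finally have "path_faces (lift_path k p) =
        range (\<lambda>s. max_face (P \<times> {0..1::real}) ((\<omega>, t) - s *\<^sub>R (c, 1)))" ..
    moreover have "(c, 1) \<noteq> (0 :: 'a \<times> real)" "(\<omega>, t) \<notin> span {(c, 1)}"
      using \<omega> by (auto simp: zero_prod_def span_singleton)
    ultimately show "coherent (P \<times> {0..1::real}) (c, 1) (lift_path k p)"
      unfolding coherent_iff_max_face[OF polytope_prism ne'] conj_assoc[symmetric]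
        independent_pair_iff by blast
  qed
qed

lemma coherent_monotone_paths_prism:
  assumes "c \<noteq> 0" and "\<omega>0 \<notin> span {c}"
  shows "coherent_monotone_paths (P \<times> {0..1::real}) (c, 1) =
    {lift_path k p |k p. p \<in> coherent_monotone_paths P c \<and> k < length p}"
  using coherent_lift_path_iff[OF _ _ assms]
  by (auto simp: coherent_monotone_paths_def monotone_paths_prism)

text \<open>An arc needs \<open>c\<close> nonzero; then \<open>P\<close> lies on the line spanned by
  \<open>c\<close>, where the middle one of three vertices cannot be extreme.\<close>

lemma length_monotone_path_le_2:
  assumes deg: "c = 0 \<or> span {c} = UNIV" and p: "p \<in> monotone_paths P c"
  shows "length p \<le> 2"
proof (rule ccontr)
  assume "\<not> length p \<le> 2"
  then obtain u v w p' where p_eq: "p = u # v # w # p'"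
    by (auto simp: not_le numeral_2_eq_2 less_eq_Suc_le Suc_le_length_iff)
  have less: "u \<bullet> c < v \<bullet> c" "v \<bullet> c < w \<bullet> c"
    and ext: "u \<in> P" "w \<in> P" "v extreme_point_of P"
    using p unfolding p_eq
    by (auto simp: monotone_paths_iff vwalk_def parcs_polytope_digraph extreme_point_of_def)
  then have "c \<noteq> 0" by auto
  then have "u \<in> span {c}" "v \<in> span {c}" "w \<in> span {c}" using deg by auto
  then obtain a b d where abd: "u = a *\<^sub>R c" "v = b *\<^sub>R c" "w = d *\<^sub>R c"
    by (auto simp: span_singleton)
  have "a < b" "b < d" using less \<open>c \<noteq> 0\<close> by (simp_all add: abd)
  define t where "t = (b - a) / (d - a)"
  have t: "0 < t" "t < 1" "t * (d - a) = b - a"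
    using \<open>a < b\<close> \<open>b < d\<close> by (simp_all add: t_def)
  have "b = (1 - t) * a + t * d" using t(3) by (simp add: algebra_simps)
  then have "v = (1 - t) *\<^sub>R u + t *\<^sub>R w" by (simp add: abd scaleR_left_distrib)
  then have "v \<in> open_segment u w" using t less by (auto simp: in_segment)
  then show False using ext by (auto simp: extreme_point_of_def)
qed

text \<open>\<open>P\<close> has no coherent paths here and gives no information, so the lengths are
  bounded directly: a lifted path has as many edges as \<open>p\<close> has vertices.\<close>

lemma log_concave_coherent_prism_degenerate:
  assumes "c = 0 \<or> span {c} = UNIV"
  shows "log_concave (length_count (coherent_monotone_paths (P \<times> {0..1::real}) (c, 1)))"
proof (rule log_concave_support_1_2)
  fix l
  assume "length_count (coherent_monotone_paths (P \<times> {0..1::real}) (c, 1)) l \<noteq> 0"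
  then have "{q \<in> coherent_monotone_paths (P \<times> {0..1::real}) (c, 1). vwalk_length q = l} \<noteq> {}"
    unfolding length_count_def by (metis card.empty)
  then obtain q where "q \<in> monotone_paths (P \<times> {0..1::real}) (c, 1)" "l = length q - 1"
    by (auto simp: coherent_monotone_paths_def)
  then obtain k p where p: "p \<in> monotone_paths P c" "k < length p" "l = length p"
    by (auto simp: monotone_paths_prism length_lift_path)
  have "length p \<le> 2" using p(1) by (rule length_monotone_path_le_2[OF assms])
  then show "l = 1 \<or> l = 2" using p(2,3) by linarith
qed

end

text \<open>No \<open>\<omega>\<close> is linearly independent from \<open>c\<close> in these
  cases.\<close>

lemma coherent_monotone_paths_degenerate:
  assumes "c = 0 \<or> span {c} = UNIV"
  shows "coherent_monotone_paths P c = {}"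
  using assms unfolding coherent_monotone_paths_def coherent_def conj_assoc[symmetric]
    independent_pair_iff by auto

lemma gen_poly_0: "(\<And>l. a l = 0) \<Longrightarrow> gen_poly a = 0"
  by (simp add: gen_poly_def)

theorem theorem3p11:
  fixes P :: "'a::euclidean_space set" and c :: 'a
  assumes "polytope P"
    and "\<exists>!v. min_vertex P c v"
    and "\<exists>!v. max_vertex P c v"
  shows
    "(log_concave (length_count (monotone_paths P c)) \<longrightarrow>
        log_concave (length_count (monotone_paths (P \<times> {0..1::real}) (c, 1)))) \<and>
     (real_rooted (gen_poly (length_count (monotone_paths P c))) \<longrightarrow>
        real_rooted (gen_poly (length_count (monotone_paths (P \<times> {0..1::real}) (c, 1))))) \<and>
     (log_concave (length_count (coherent_monotone_paths P c)) \<longrightarrow>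
        log_concave (length_count (coherent_monotone_paths (P \<times> {0..1::real}) (c, 1)))) \<and>
     (real_rooted (gen_poly (length_count (coherent_monotone_paths P c))) \<longrightarrow>
        real_rooted (gen_poly (length_count (coherent_monotone_paths (P \<times> {0..1::real}) (c, 1)))))"
proof -
  \<comment> \<open>Stated for any set \<open>S\<close> of monotone paths, so that it serves both
    counts.\<close>
  have transfer: "(log_concave (length_count S) \<longrightarrow> log_concave (length_count S')) \<and>
      (real_rooted (gen_poly (length_count S)) \<longrightarrow> real_rooted (gen_poly (length_count S')))"
    if "S \<subseteq> monotone_paths P c" and "S' = {lift_path k p |k p. p \<in> S \<and> k < length p}" for S S'
  proof -
    have fin: "finite S"
      using that(1) finite_monotone_paths[OF assms(1)] finite_subset by blast
    have "p \<noteq> []" if "p \<in> S" for p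
      using that \<open>S \<subseteq> monotone_paths P c\<close> by (auto simp: monotone_paths_iff vwalk_def)
    note count = length_count_lift_path[OF fin this that(2)]
    show ?thesis
      using log_concave_shift[OF count]
        real_rooted_gen_poly_shift[OF finite_length_count_support[OF fin] count]
      by blast
  qed
  have "(log_concave (length_count (coherent_monotone_paths P c)) \<longrightarrow>
        log_concave (length_count (coherent_monotone_paths (P \<times> {0..1::real}) (c, 1)))) \<and>
     (real_rooted (gen_poly (length_count (coherent_monotone_paths P c))) \<longrightarrow>
        real_rooted (gen_poly (length_count (coherent_monotone_paths (P \<times> {0..1::real}) (c, 1)))))"
  proof (cases "c = 0 \<or> span {c} = UNIV")
    case True
    \<comment> \<open>The generating polynomial is 0, hence not \<open>real_rooted\<close>, and the
      second implication is vacuous.\<close>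
    have "gen_poly (length_count (coherent_monotone_paths P c)) = 0"
      unfolding coherent_monotone_paths_degenerate[OF True]
      by (rule gen_poly_0) (simp add: length_count_def)
    then show ?thesis
      using log_concave_coherent_prism_degenerate[OF assms(1) True] not_real_rooted_0 by simp
  next
    case False
    then obtain \<omega> where "c \<noteq> 0" "\<omega> \<notin> span {c}" by auto
    then show ?thesis
      using transfer[OF _ coherent_monotone_paths_prism[OF assms(1)]]
      by (auto simp: coherent_monotone_paths_def)
  qed
  then show ?thesis
    using transfer[OF order_refl monotone_paths_prism] by blast
qed

end
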